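(* Let $\Phi:M_n(\mathbb{C})\to M_n(\mathbb{C})$ be a quantum channel with linearly independent Kraus operators $K=(K_1,\dots,K_d)$, $K_i\in M_n(\mathbb{R})$. If $\Phi$ is positively factorizable, then the nonnegativity cone $NC(K)\subseteq\mathbb{R}^d$ contains a self-dual cone, i.e. there is a cone $C\subseteq \mathbb{R}^d$ with $C=C^*$ and $C\subseteq NC(K)$.
   Context: A quantum channel is a trace-preserving completely positive linear map $\Phi:M_n(\mathbb{C})\to M_n(\mathbb{C})$; matrices $K_1,\dots,K_d\in M_n(\mathbb{C})$ are Kraus operators for $\Phi$ if $\Phi(X)=\sum_{i=1}^d K_iXK_i^*$ for all $X$. Positively factorizable: a channel $\Phi$ is positively factorizable if there exist a finite von Neumann algebra $\mathcal{A}$ with a faithful normal (finite) trace $\tau$ and $Z=(Z(i,j))\in M_n(\mathbb{C})\otimes\mathcal{A}=M_n(\mathcal{A})$, each entry $Z(i,j)$ being a positive element of $\mathcal{A}$, such that $\Phi(X)=(\mathrm{id}\otimes\tau)(Z(X\otimes 1_{\mathcal{A}})Z^* )$ for all $X\in M_n(\mathbb{C})$. Equivalently, for linearly independent Kraus operators $K_1,\dots,K_d$ of $\Phi$, there are such $(\mathcal{A},\tau)$ and $A_1,\dots,A_d\in\mathcal{A}$ with $\tau(A_i^*A_j)=\delta_{ij}$ such that all entries of $Z=\sum_{i=1}^d K_i\otimes A_i\in M_n(\mathcal{A})$ are positive elements of $\mathcal{A}$. Nonnegativity cone: for $K=(K_1,\dots,K_d)\in M_n(\mathbb{R})^d$,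 $NC(K)=\{v\in\mathbb{R}^d:\sum_{i=1}^d v_iK_i \text{ is entrywise nonnegative}\}$. For $S\subseteq\mathbb{R}^d$ the dual cone is $S^*=\{y\in\mathbb{R}^d:\langle y,x\rangle\ge 0\ \forall x\in S\}$; a cone $C\subseteq\mathbb{R}^d$ is self-dual if $C^*=C$. *)

theory Defs
  imports "HOL-Analysis.Analysis"
begin

section \<open>Complex Hilbert spaces\<close>

text \<open>The norm and metric are those of the underlying real inner product space, whose inner product
  is the real part of the complex one. The complex inner product is linear in its second argument.\<close>

class chilbert_space = real_inner + complete_space +
  fixes scaleC :: "complex \<Rightarrow> 'a \<Rightarrow> 'a"  (infixr \<open>*\<^sub>C\<close> 75)
    and cinner :: "'a \<Rightarrow> 'a \<Rightarrow> complex"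
  assumes scaleC_add_right: "c *\<^sub>C (x + y) = c *\<^sub>C x + c *\<^sub>C y"
    and scaleC_add_left: "(b + c) *\<^sub>C x = b *\<^sub>C x + c *\<^sub>C x"
    and scaleC_scaleC: "b *\<^sub>C (c *\<^sub>C x) = (b * c) *\<^sub>C x"
    and scaleC_of_real: "complex_of_real r *\<^sub>C x = r *\<^sub>R x"
    and cinner_commute: "cinner x y = cnj (cinner y x)"
    and cinner_add_right: "cinner x (y + z) = cinner x y + cinner x z"
    and cinner_scaleC_right: "cinner x (c *\<^sub>C y) = c * cinner x y"
    and Re_cinner: "Re (cinner x y) = inner x y"

instantiation complex :: chilbert_space
begin

definition scaleC_complex :: "complex \<Rightarrow> complex \<Rightarrow> complex"
  where "scaleC_complex c x = c * x"

definition cinner_complex :: "complex \<Rightarrow> complex \<Rightarrow> complex"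
  where "cinner_complex x y = cnj x * y"

instance
  by standard
    (simp_all add: scaleC_complex_def cinner_complex_def algebra_simps scaleR_conv_of_real inner_complex_def)

end

section \<open>Bounded operators\<close>

text \<open>The elements of \<open>B(H)\<close> are the complex linear members of the type of bounded real linear
  operators on \<open>H\<close>.\<close>

definition clinear_op :: "('h::chilbert_space \<Rightarrow>\<^sub>L 'h) \<Rightarrow> bool"
  where "clinear_op T \<longleftrightarrow> (\<forall>c x. blinfun_apply T (c *\<^sub>C x) = c *\<^sub>C blinfun_apply T x)"

text \<open>The operator \<open>c 1\<close>.\<close>

lift_definition scalar_op :: "complex \<Rightarrow> 'h::chilbert_space \<Rightarrow>\<^sub>L 'h" is "\<lambda>c x. c *\<^sub>C x"
proof -
  fix c :: complex
  have n: "norm (c *\<^sub>C x) = norm x * cmod c" for x :: 'h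
  proof -
    have sq: "cinner y y = complex_of_real ((norm y)\<^sup>2)" for y :: 'h
      using cinner_commute[of y y] Re_cinner[of y y]
      by (simp add: complex_eq_iff power2_norm_eq_inner)
    have "cinner (c *\<^sub>C x) (c *\<^sub>C x) = c * cnj (cinner x (c *\<^sub>C x))"
      by (metis cinner_commute cinner_scaleC_right)
    also have "\<dots> = c * cnj c * complex_of_real ((norm x)\<^sup>2)"
      by (simp add: cinner_scaleC_right sq)
    also have "\<dots> = complex_of_real ((norm x * cmod c)\<^sup>2)"
      by (simp add: complex_mult_cnj cmod_power2 power_mult_distrib)
    finally have "(norm (c *\<^sub>C x))\<^sup>2 = (norm x * cmod c)\<^sup>2"
      unfolding sq of_real_eq_iff .
    then show ?thesis
      by (simp add: power2_eq_iff_nonneg)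
  qed
  show "bounded_linear ((*\<^sub>C) c :: 'h \<Rightarrow> 'h)"
  proof (rule bounded_linear_intro)
    fix r and x :: 'h
    show "c *\<^sub>C (r *\<^sub>R x) = r *\<^sub>R (c *\<^sub>C x)"
      by (simp add: scaleC_scaleC mult.commute flip: scaleC_of_real)
    show "norm (c *\<^sub>C x) \<le> norm x * cmod c"
      by (simp add: n)
  qed (simp add: scaleC_add_right)
qed

definition is_adjoint :: "('h::chilbert_space \<Rightarrow>\<^sub>L 'h) \<Rightarrow> ('h \<Rightarrow>\<^sub>L 'h) \<Rightarrow> bool"
  where "is_adjoint S T \<longleftrightarrow> (\<forall>x y. cinner (blinfun_apply S x) y = cinner x (blinfun_apply T y))"

lemma is_adjoint_unique:
  assumes "is_adjoint S T" "is_adjoint S' T"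
  shows "S = S'"
proof (rule blinfun_eqI)
  fix x
  have "inner (blinfun_apply S x) y = inner (blinfun_apply S' x) y" for y
    using assms by (simp add: is_adjoint_def flip: Re_cinner)
  then show "blinfun_apply S x = blinfun_apply S' x"
    by (metis inner_commute vector_eq_rdot)
qed

text \<open>For complex linear \<open>T\<close> the adjoint exists by the Riesz representation theorem.\<close>

definition adj :: "('h::chilbert_space \<Rightarrow>\<^sub>L 'h) \<Rightarrow> ('h \<Rightarrow>\<^sub>L 'h)"
  where "adj T = (THE S. is_adjoint S T)"

definition positive_op :: "('h::chilbert_space \<Rightarrow>\<^sub>L 'h) \<Rightarrow> bool"
  where "positive_op T \<longleftrightarrow> clinear_op T \<and> (\<forall>x. cinner x (blinfun_apply T x) \<in> \<real>\<^sub>\<ge>\<^sub>0)"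

section \<open>Von Neumann algebras and traces\<close>

definition commutant :: "('h::chilbert_space \<Rightarrow>\<^sub>L 'h) set \<Rightarrow> ('h \<Rightarrow>\<^sub>L 'h) set"
  where "commutant S = {T. clinear_op T \<and> (\<forall>U\<in>S. T o\<^sub>L U = U o\<^sub>L T)}"

definition von_neumann_algebra :: "('h::chilbert_space \<Rightarrow>\<^sub>L 'h) set \<Rightarrow> bool"
  where "von_neumann_algebra A \<longleftrightarrow>
    (\<forall>T\<in>A. clinear_op T) \<and> (\<forall>T\<in>A. adj T \<in> A) \<and> commutant (commutant A) = A"

text \<open>Finite: every isometry in the algebra is unitary.\<close>

definition finite_von_neumann_algebra :: "('h::chilbert_space \<Rightarrow>\<^sub>L 'h) set \<Rightarrow> bool"
  where "finite_von_neumann_algebra A \<longleftrightarrow> von_neumann_algebra A \<and>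
    (\<forall>V\<in>A. adj V o\<^sub>L V = id_blinfun \<longrightarrow> V o\<^sub>L adj V = id_blinfun)"

text \<open>A finite trace, that is, an everywhere defined positive tracial linear functional. Only the
  values on \<open>A\<close> matter, and no normalization of the value at the identity is imposed.\<close>

definition finite_trace :: "('h::chilbert_space \<Rightarrow>\<^sub>L 'h) set \<Rightarrow> (('h \<Rightarrow>\<^sub>L 'h) \<Rightarrow> complex) \<Rightarrow> bool"
  where "finite_trace A \<tau> \<longleftrightarrow>
    (\<forall>S\<in>A. \<forall>T\<in>A. \<tau> (S + T) = \<tau> S + \<tau> T) \<and>
    (\<forall>c. \<forall>T\<in>A. \<tau> (scalar_op c o\<^sub>L T) = c * \<tau> T) \<and>
    (\<forall>T\<in>A. positive_op T \<longrightarrow> \<tau> T \<in> \<real>\<^sub>\<ge>\<^sub>0) \<and>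
    (\<forall>S\<in>A. \<forall>T\<in>A. \<tau> (S o\<^sub>L T) = \<tau> (T o\<^sub>L S))"

definition faithful :: "('h::chilbert_space \<Rightarrow>\<^sub>L 'h) set \<Rightarrow> (('h \<Rightarrow>\<^sub>L 'h) \<Rightarrow> complex) \<Rightarrow> bool"
  where "faithful A \<tau> \<longleftrightarrow> (\<forall>T\<in>A. positive_op T \<and> \<tau> T = 0 \<longrightarrow> T = 0)"

text \<open>Normality: \<open>\<tau>\<close> preserves suprema of bounded upward directed families of positive elements.\<close>

definition op_le :: "('h::chilbert_space \<Rightarrow>\<^sub>L 'h) \<Rightarrow> ('h \<Rightarrow>\<^sub>L 'h) \<Rightarrow> bool"
  where "op_le S T \<longleftrightarrow> positive_op (T - S)"

definition op_lub_in :: "('h::chilbert_space \<Rightarrow>\<^sub>L 'h) set \<Rightarrow> ('h \<Rightarrow>\<^sub>L 'h) set \<Rightarrow> ('h \<Rightarrow>\<^sub>L 'h) \<Rightarrow> bool"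
  where "op_lub_in A D S \<longleftrightarrow>
    S \<in> A \<and> (\<forall>T\<in>D. op_le T S) \<and> (\<forall>U\<in>A. (\<forall>T\<in>D. op_le T U) \<longrightarrow> op_le S U)"

definition normal_functional ::
    "('h::chilbert_space \<Rightarrow>\<^sub>L 'h) set \<Rightarrow> (('h \<Rightarrow>\<^sub>L 'h) \<Rightarrow> complex) \<Rightarrow> bool"
  where "normal_functional A \<tau> \<longleftrightarrow>
    (\<forall>D S. D \<subseteq> {T\<in>A. positive_op T} \<and> D \<noteq> {} \<and>
      (\<forall>T\<in>D. \<forall>U\<in>D. \<exists>V\<in>D. op_le T V \<and> op_le U V) \<and> op_lub_in A D S \<longrightarrow>
      Re (\<tau> S) = (SUP T\<in>D. Re (\<tau> T)))"

section \<open>Matrices over the operators\<close>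

definition opmat_mult ::
    "('h::chilbert_space \<Rightarrow>\<^sub>L 'h)^'m^'n \<Rightarrow> ('h \<Rightarrow>\<^sub>L 'h)^'p^'m \<Rightarrow> ('h \<Rightarrow>\<^sub>L 'h)^'p^'n"
  where "opmat_mult Y Z = (\<chi> i j. \<Sum>k\<in>UNIV. Y $ i $ k o\<^sub>L Z $ k $ j)"

definition opmat_adj :: "('h::chilbert_space \<Rightarrow>\<^sub>L 'h)^'m^'n \<Rightarrow> ('h \<Rightarrow>\<^sub>L 'h)^'n^'m"
  where "opmat_adj Z = (\<chi> i j. adj (Z $ j $ i))"

text \<open>\<open>X \<otimes> 1\<close> and \<open>(id \<otimes> \<tau>)(W)\<close>.\<close>

definition tensor_one :: "complex^'m^'n \<Rightarrow> ('h::chilbert_space \<Rightarrow>\<^sub>L 'h)^'m^'n"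
  where "tensor_one X = map_matrix scalar_op X"

definition id_tensor ::
    "(('h::chilbert_space \<Rightarrow>\<^sub>L 'h) \<Rightarrow> complex) \<Rightarrow> ('h \<Rightarrow>\<^sub>L 'h)^'m^'n \<Rightarrow> complex^'m^'n"
  where "id_tensor \<tau> W = map_matrix \<tau> W"

section \<open>Quantum channels\<close>

definition cmatrix_adj :: "complex^'m^'n \<Rightarrow> complex^'n^'m"
  where "cmatrix_adj M = map_matrix cnj (transpose M)"

abbreviation cmatrix_scale :: "complex \<Rightarrow> complex^'m^'n \<Rightarrow> complex^'m^'n"
  where "cmatrix_scale c M \<equiv> map_matrix ((*) c) M"

definition cmatrix_linear :: "(complex^'n^'n \<Rightarrow> complex^'n^'n) \<Rightarrow> bool"
  where "cmatrix_linear \<Phi> \<longleftrightarrow>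
    (\<forall>X Y. \<Phi> (X + Y) = \<Phi> X + \<Phi> Y) \<and> (\<forall>c X. \<Phi> (cmatrix_scale c X) = cmatrix_scale c (\<Phi> X))"

text \<open>Positive semidefiniteness in \<open>M\<^sub>k(M\<^sub>n(\<complex>))\<close>; only the blocks \<open>X a b\<close> with \<open>a, b < k\<close> matter.\<close>

definition block_psd :: "nat \<Rightarrow> (nat \<Rightarrow> nat \<Rightarrow> complex^'n^'n) \<Rightarrow> bool"
  where "block_psd k X \<longleftrightarrow>
    (\<forall>v :: nat \<Rightarrow> complex^'n.
      (\<Sum>a<k. \<Sum>b<k. \<Sum>i\<in>UNIV. \<Sum>j\<in>UNIV. cnj (v a $ i) * X a b $ i $ j * v b $ j) \<in> \<real>\<^sub>\<ge>\<^sub>0)"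

definition completely_positive :: "(complex^'n^'n \<Rightarrow> complex^'n^'n) \<Rightarrow> bool"
  where "completely_positive \<Phi> \<longleftrightarrow>
    (\<forall>k X. block_psd k X \<longrightarrow> block_psd k (\<lambda>a b. \<Phi> (X a b)))"

definition quantum_channel :: "(complex^'n^'n \<Rightarrow> complex^'n^'n) \<Rightarrow> bool"
  where "quantum_channel \<Phi> \<longleftrightarrow>
    cmatrix_linear \<Phi> \<and> completely_positive \<Phi> \<and> (\<forall>X. trace (\<Phi> X) = trace X)"

definition kraus_operators ::
    "(complex^'n^'n \<Rightarrow> complex^'n^'n) \<Rightarrow> ('d::finite \<Rightarrow> complex^'n^'n) \<Rightarrow> bool"
  where "kraus_operators \<Phi> K \<longleftrightarrow> (\<forall>X. \<Phi> X = (\<Sum>i\<in>UNIV. K i ** X ** cmatrix_adj (K i)))"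

definition lin_independent_family :: "('d::finite \<Rightarrow> complex^'m^'n) \<Rightarrow> bool"
  where "lin_independent_family K \<longleftrightarrow>
    (\<forall>c. (\<Sum>i\<in>UNIV. cmatrix_scale (c i) (K i)) = 0 \<longrightarrow> (\<forall>i. c i = 0))"

text \<open>A definition cannot quantify over types, so the Hilbert space on which the von Neumann algebra
  acts is a parameter. A hypothesis \<open>positively_factorizable TYPE('h) \<Phi>\<close> with a type variable
  \<open>'h\<close> that occurs nowhere else covers all Hilbert spaces.\<close>

definition positively_factorizable ::
    "'h::chilbert_space itself \<Rightarrow> (complex^'n^'n \<Rightarrow> complex^'n^'n) \<Rightarrow> bool"
  where "positively_factorizable _ \<Phi> \<longleftrightarrow>
    (\<exists>(A :: ('h \<Rightarrow>\<^sub>L 'h) set) \<tau> (Z :: ('h \<Rightarrow>\<^sub>L 'h)^'n^'n).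
      finite_von_neumann_algebra A \<and>
      finite_trace A \<tau> \<and> faithful A \<tau> \<and> normal_functional A \<tau> \<and>
      (\<forall>i j. Z $ i $ j \<in> A \<and> positive_op (Z $ i $ j)) \<and>
      (\<forall>X. \<Phi> X = id_tensor \<tau> (opmat_mult (opmat_mult Z (tensor_one X)) (opmat_adj Z))))"

section \<open>Cones\<close>

definition nonnegativity_cone :: "('d::finite \<Rightarrow> real^'m^'n) \<Rightarrow> (real^'d) set"
  where "nonnegativity_cone K = {v. \<forall>k l. 0 \<le> (\<Sum>i\<in>UNIV. v $ i *\<^sub>R K i) $ k $ l}"

definition dual_cone :: "(real^'d) set \<Rightarrow> (real^'d) set"
  where "dual_cone S = {y. \<forall>x\<in>S. 0 \<le> inner y x}"

end

theory Submission
  imports Defs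
begin

text \<open>Let \<open>w\<^sub>k\<^sub>l \<in> \<real>\<^sup>d\<close> be the vector of the \<open>(k, l)\<close> entries of the \<open>K\<^sub>i\<close>. Comparing the Kraus form and
  the factorization on matrix units gives \<open>\<langle>w\<^sub>k\<^sub>l, w\<^sub>i\<^sub>j\<rangle> = \<tau>(Z\<^sub>k\<^sub>l Z\<^sub>i\<^sub>j)\<close>, which is nonnegative since the
  trace of a product of two positive elements is. The nonnegativity cone is the dual of
  \<open>{w\<^sub>k\<^sub>l}\<close>, so it contains every self-dual cone containing \<open>{w\<^sub>k\<^sub>l}\<close>. By Zorn, \<open>{w\<^sub>k\<^sub>l}\<close> lies in a maximal
  set \<open>C\<close> with pairwise nonnegative inner products, and maximality forces \<open>C\<close> to be self-dual.\<close>

section \<open>Self-dual cones\<close>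

lemma cone_dual_cone: "cone (dual_cone S)"
  by (auto simp: cone_def dual_cone_def)

lemma exists_self_dual_cone_containing:
  fixes S :: "(real^'d) set"
  assumes "\<And>x y. x \<in> S \<Longrightarrow> y \<in> S \<Longrightarrow> 0 \<le> inner x y"
  obtains C where "cone C" "dual_cone C = C" "S \<subseteq> C"
proof -
  define F where "F = {M. S \<subseteq> M \<and> (\<forall>x\<in>M. \<forall>y\<in>M. 0 \<le> inner x y)}"
  have "S \<in> F"
    using assms by (auto simp: F_def)
  moreover have "\<Union>\<C> \<in> F" if "\<C> \<noteq> {}" "subset.chain F \<C>" for \<C>
  proof -
    have "0 \<le> inner x y" if "x \<in> M" "M \<in> \<C>" "y \<in> N" "N \<in> \<C>" for x y M N
    proof -
      have "M \<subseteq> N \<or> N \<subseteq> M" "M \<in> F" "N \<in> F"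
        using that \<open>subset.chain F \<C>\<close> by (auto simp: subset_chain_def)
      then show ?thesis
        using that by (auto simp: F_def)
    qed
    moreover have "S \<subseteq> \<Union>\<C>"
      using that by (fastforce simp: subset_chain_def F_def)
    ultimately show ?thesis
      by (auto simp: F_def)
  qed
  ultimately obtain C where C: "C \<in> F" and max: "\<And>M. M \<in> F \<Longrightarrow> C \<subseteq> M \<Longrightarrow> M = C"
    using subset_Zorn_nonempty[of F] by blast
  have "y \<in> C" if "y \<in> dual_cone C" for y
  proof -
    \<comment> \<open>The only new pairing not covered by \<open>y \<in> dual_cone C\<close> is
      \<open>inner y y\<close>, which is a square.\<close>
    have "insert y C \<in> F"
      using C that by (auto simp: F_def dual_cone_def inner_commute)
    then show ?thesis
      using max by blast
  qed
  then have "dual_cone C = C"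
    using C by (auto simp: F_def dual_cone_def)
  \<comment> \<open>That \<open>C\<close> is a cone is read off from \<open>C = dual_cone C\<close>,
    since every dual cone is one.\<close>
  with C show ?thesis
    using that[of C] cone_dual_cone[of C] by (auto simp: F_def)
qed

section \<open>Complex inner products and positive operators\<close>

lemma cinner_add_left: "cinner (x + y) z = cinner x z + cinner y (z :: 'h::chilbert_space)"
  by (metis cinner_add_right cinner_commute complex_cnj_add)

lemma cinner_scaleC_left: "cinner (c *\<^sub>C x) y = cnj c * cinner x (y :: 'h::chilbert_space)"
  by (metis cinner_commute cinner_scaleC_right complex_cnj_mult)

lemma scaleC_zero_left [simp]: "0 *\<^sub>C x = (0 :: 'h::chilbert_space)"
  using scaleC_of_real[of 0 x] by simp

lemma scaleC_one [simp]: "1 *\<^sub>C x = (x :: 'h::chilbert_space)"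
  using scaleC_of_real[of 1 x] by simp

lemma blinfun_compose_id: "T o\<^sub>L id_blinfun = T"
  by (rule blinfun_eqI) simp

lemma blinfun_compose_assoc: "R o\<^sub>L S o\<^sub>L T = R o\<^sub>L (S o\<^sub>L T)"
  by (rule blinfun_eqI) simp

lemma scalar_op_0 [simp]: "scalar_op 0 = 0"
  by (rule blinfun_eqI) (simp add: scalar_op.rep_eq)

lemma scalar_op_1 [simp]: "scalar_op 1 = id_blinfun"
  by (rule blinfun_eqI) (simp add: scalar_op.rep_eq)

lemma scalar_op_of_real_compose: "scalar_op (complex_of_real r) o\<^sub>L T = r *\<^sub>R T"
  by (rule blinfun_eqI) (simp add: scalar_op.rep_eq scaleC_of_real blinfun.scaleR_left)

text \<open>Polarization: expanding the real quadratic form at \<open>x + y\<close> relates the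
  imaginary parts of the cross terms, and replacing \<open>y\<close> by
  \<open>\<i> *\<^sub>C y\<close> gives the same for the real parts.\<close>

lemma is_adjoint_self_if_positive_op:
  assumes "positive_op T"
  shows "is_adjoint T T"
proof -
  have T: "T (c *\<^sub>C x) = c *\<^sub>C T x" for c x
    using assms by (simp add: positive_op_def clinear_op_def)
  have im: "Im (cinner x (T x)) = 0" for x
    using assms by (auto simp: positive_op_def complex_nonneg_Reals_iff)
  have swap: "Im (cinner x (T y)) + Im (cinner y (T x)) = 0" for x y
    using im[of "x + y"] im[of x] im[of y]
    by (simp add: blinfun.add_right cinner_add_left cinner_add_right)
  have "cinner (T x) y = cinner x (T y)" for x y
  proof -
    have "Re (cinner x (T y)) = Re (cinner y (T x))"
      using swap[of x "\<i> *\<^sub>C y"] by (simp add: T cinner_scaleC_left cinner_scaleC_right)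
    with swap[of x y] have "cinner x (T y) = cnj (cinner y (T x))"
      by (simp add: complex_eq_iff)
    then show ?thesis
      by (metis cinner_commute)
  qed
  then show ?thesis
    by (simp add: is_adjoint_def)
qed

lemma adj_positive_op: "positive_op T \<Longrightarrow> adj T = T"
  unfolding adj_def using is_adjoint_self_if_positive_op is_adjoint_unique by blast

lemma positive_op_add: "positive_op S \<Longrightarrow> positive_op T \<Longrightarrow> positive_op (S + T)"
  by (simp add: positive_op_def clinear_op_def blinfun.add_left scaleC_add_right cinner_add_right
      complex_nonneg_Reals_iff)

lemma positive_op_conj:
  assumes "is_adjoint S S" "clinear_op S" "positive_op T"
  shows "positive_op (S o\<^sub>L T o\<^sub>L S)"
  unfolding positive_op_def
proof (intro conjI allI)
  show "clinear_op (S o\<^sub>L T o\<^sub>L S)"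
    using assms by (simp add: clinear_op_def positive_op_def)
  fix x
  have "cinner x ((S o\<^sub>L T o\<^sub>L S) x) = cinner (S x) (T (S x))"
    using assms(1) by (simp add: is_adjoint_def)
  then show "cinner x ((S o\<^sub>L T o\<^sub>L S) x) \<in> \<real>\<^sub>\<ge>\<^sub>0"
    using assms(3) by (simp add: positive_op_def)
qed

lemma positive_op_id: "positive_op id_blinfun"
proof -
  have "cinner x x \<in> \<real>\<^sub>\<ge>\<^sub>0" for x :: 'a
  proof -
    have "Im (cinner x x) = 0"
      using cinner_commute[of x x] by (simp add: complex_eq_iff)
    then show ?thesis
      by (simp add: complex_nonneg_Reals_iff Re_cinner)
  qed
  then show ?thesis
    by (simp add: positive_op_def clinear_op_def)
qed

lemma positive_op_square:
  assumes "is_adjoint S S" "clinear_op S"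
  shows "positive_op (S o\<^sub>L S)"
  using positive_op_conj[OF assms positive_op_id] by (simp add: blinfun_compose_id)

lemma positive_op_scaleR:
  assumes "positive_op T" "0 \<le> r"
  shows "positive_op (r *\<^sub>R T)"
  using assms
  by (auto simp: positive_op_def clinear_op_def blinfun.scaleR_left scaleC_scaleC mult.commute
      cinner_scaleC_right complex_nonneg_Reals_iff simp flip: scaleC_of_real)

lemma positive_op_id_diff:
  assumes "positive_op T" "norm T \<le> 1"
  shows "positive_op (id_blinfun - T)"
proof -
  have "Re (cinner x (T x)) \<le> inner x x" for x
  proof -
    have "norm x * norm (T x) \<le> norm x * norm x"
    proof (rule mult_left_mono)
      have "norm (T x) \<le> norm T * norm x"
        by (rule norm_blinfun)
      also have "\<dots> \<le> norm x"
        using assms(2) by (simp add: mult_left_le_one_le)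
      finally show "norm (T x) \<le> norm x" .
    qed simp
    then show ?thesis
      using norm_cauchy_schwarz[of x "T x"]
      by (simp add: Re_cinner power2_eq_square flip: power2_norm_eq_inner)
  qed
  moreover have "cinner x (y - z) = cinner x y - cinner x z" for x y z :: 'a
    by (metis add_diff_cancel diff_add_cancel cinner_add_right)
  moreover have "c *\<^sub>C (y - z) = c *\<^sub>C y - c *\<^sub>C z" for c and y z :: 'a
    by (metis add_diff_cancel diff_add_cancel scaleC_add_right)
  moreover have "Im (cinner x x) = 0" for x :: 'a
    using positive_op_id by (auto simp: positive_op_def complex_nonneg_Reals_iff)
  ultimately show ?thesis
    using assms(1)
    by (auto simp: positive_op_def clinear_op_def blinfun.diff_left complex_nonneg_Reals_iff Re_cinner)
qed

text \<open>Writing S - S^2 = S(1 - S)S + (1 - S)S(1 - S) exhibits it as a sum of two conjugates of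
  positive operators, without a square root.\<close>

lemma positive_op_diff_square:
  assumes "positive_op S" "positive_op (id_blinfun - S)"
  shows "positive_op (S - (S o\<^sub>L S))"
proof -
  let ?R = "id_blinfun - S"
  have "S - (S o\<^sub>L S) = (S o\<^sub>L ?R o\<^sub>L S) + (?R o\<^sub>L S o\<^sub>L ?R)"
    by (rule blinfun_eqI) (simp add: blinfun.bilinear_simps)
  moreover have "clinear_op S" "clinear_op ?R"
    using assms by (auto simp: positive_op_def)
  ultimately show ?thesis
    using assms by (simp add: positive_op_add positive_op_conj is_adjoint_self_if_positive_op)
qed

section \<open>Algebraic closure of von Neumann algebras\<close>

context
  fixes A :: "('h::chilbert_space \<Rightarrow>\<^sub>L 'h) set"
  assumes vna: "von_neumann_algebra A"
begin

text \<open>The bicommutant equation turns membership into commutation relations, so closure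
  properties become identities of composition.\<close>

lemma mem_von_neumann_algebra_iff:
  "T \<in> A \<longleftrightarrow> clinear_op T \<and> (\<forall>U\<in>commutant A. T o\<^sub>L U = U o\<^sub>L T)"
  using vna by (auto simp: von_neumann_algebra_def commutant_def)

lemma von_neumann_algebra_add:
  assumes "S \<in> A" "T \<in> A"
  shows "S + T \<in> A"
  using assms unfolding mem_von_neumann_algebra_iff
  by (simp add: clinear_op_def blinfun.add_left scaleC_add_right
      bounded_bilinear.add_left[OF bounded_bilinear_blinfun_compose]
      bounded_bilinear.add_right[OF bounded_bilinear_blinfun_compose])

lemma von_neumann_algebra_compose:
  assumes "S \<in> A" "T \<in> A"
  shows "S o\<^sub>L T \<in> A"
  using assms unfolding mem_von_neumann_algebra_iff
  by (simp add: clinear_op_def) (metis blinfun_compose_assoc)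

lemma von_neumann_algebra_scaleR:
  assumes "T \<in> A"
  shows "r *\<^sub>R T \<in> A"
  using assms unfolding mem_von_neumann_algebra_iff
  by (simp add: clinear_op_def blinfun.scaleR_left scaleC_scaleC mult.commute
      bounded_bilinear.scaleR_left[OF bounded_bilinear_blinfun_compose]
      bounded_bilinear.scaleR_right[OF bounded_bilinear_blinfun_compose] flip: scaleC_of_real)

lemma von_neumann_algebra_diff:
  assumes "S \<in> A" "T \<in> A"
  shows "S - T \<in> A"
  using von_neumann_algebra_add[OF assms(1) von_neumann_algebra_scaleR[OF assms(2), of "-1"]] by simp

section \<open>The trace of a product of positive elements\<close>

context
  fixes \<tau> :: "('h \<Rightarrow>\<^sub>L 'h) \<Rightarrow> complex"
  assumes trace: "finite_trace A \<tau>"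
begin

lemma finite_trace_add: "S \<in> A \<Longrightarrow> T \<in> A \<Longrightarrow> \<tau> (S + T) = \<tau> S + \<tau> T"
  using trace by (simp add: finite_trace_def)

lemma finite_trace_scaleR: "T \<in> A \<Longrightarrow> \<tau> (r *\<^sub>R T) = complex_of_real r * \<tau> T"
  using trace by (simp add: finite_trace_def flip: scalar_op_of_real_compose)

lemma finite_trace_diff: "S \<in> A \<Longrightarrow> T \<in> A \<Longrightarrow> \<tau> (S - T) = \<tau> S - \<tau> T"
  using finite_trace_add[of S "(-1) *\<^sub>R T"] finite_trace_scaleR[of T "-1"]
    von_neumann_algebra_scaleR[of T "-1"] by simp

lemma finite_trace_commute: "S \<in> A \<Longrightarrow> T \<in> A \<Longrightarrow> \<tau> (S o\<^sub>L T) = \<tau> (T o\<^sub>L S)"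
  using trace by (simp add: finite_trace_def)

lemma finite_trace_nonneg: "T \<in> A \<Longrightarrow> positive_op T \<Longrightarrow> 0 \<le> Re (\<tau> T)"
  using trace by (auto simp: finite_trace_def complex_nonneg_Reals_iff)

text \<open>This is the trace of (T + tS)^2, with the two mixed terms merged by traciality. Keeping
  \<open>t\<close> as a parameter, instead of passing to a discriminant, allows a limit in the
  coefficients at fixed \<open>t\<close>.\<close>

lemma finite_trace_cauchy_schwarz:
  assumes "S \<in> A" "T \<in> A" "positive_op S" "positive_op T" "0 \<le> t"
  shows "0 \<le> Re (\<tau> (T o\<^sub>L T)) + 2 * t * Re (\<tau> (S o\<^sub>L T)) + t\<^sup>2 * Re (\<tau> (S o\<^sub>L S))"
proof -
  let ?U = "T + t *\<^sub>R S"
  have "positive_op ?U"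
    using assms by (simp add: positive_op_add positive_op_scaleR)
  then have "positive_op (?U o\<^sub>L ?U)"
    by (intro positive_op_square is_adjoint_self_if_positive_op) (auto simp: positive_op_def)
  moreover have "?U o\<^sub>L ?U \<in> A"
    by (intro von_neumann_algebra_compose von_neumann_algebra_add von_neumann_algebra_scaleR assms)
  ultimately have "0 \<le> Re (\<tau> (?U o\<^sub>L ?U))"
    by (rule finite_trace_nonneg[rotated])
  also have "?U o\<^sub>L ?U = (T o\<^sub>L T) + t *\<^sub>R ((S o\<^sub>L T) + (T o\<^sub>L S)) + t\<^sup>2 *\<^sub>R (S o\<^sub>L S)"
    by (rule blinfun_eqI) (simp add: blinfun.bilinear_simps algebra_simps power2_eq_square)
  also have "Re (\<tau> \<dots>) = Re (\<tau> (T o\<^sub>L T)) + 2 * t * Re (\<tau> (S o\<^sub>L T)) + t\<^sup>2 * Re (\<tau> (S o\<^sub>L S))"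
    using assms finite_trace_commute[of T S]
    by (simp add: finite_trace_add finite_trace_scaleR von_neumann_algebra_add
        von_neumann_algebra_compose von_neumann_algebra_scaleR del: of_real_power)
  finally show ?thesis .
qed

text \<open>For \<open>0 \<le> S \<le> 1\<close> iterate \<open>S \<mapsto> S - S\<^sup>2\<close>. Each step lowers \<open>\<tau>(S T)\<close> by \<open>\<tau>(S T S) \<ge> 0\<close> and \<open>\<tau>(S)\<close> by
  \<open>\<tau>(S\<^sup>2)\<close>, so \<open>\<tau>(S\<^sub>n\<^sup>2) \<rightarrow> 0\<close>, and Cauchy--Schwarz makes \<open>\<tau>(S\<^sub>n T) \<rightarrow> 0\<close>. This avoids the square root
  of \<open>S\<close>.\<close>

lemma finite_trace_compose_nonneg_contraction:
  assumes "S \<in> A" "T \<in> A" "positive_op S" "positive_op T" "positive_op (id_blinfun - S)"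
  shows "0 \<le> Re (\<tau> (S o\<^sub>L T))"
proof -
  define s where "s n = ((\<lambda>U. U - (U o\<^sub>L U)) ^^ n) S" for n
  have s_0: "s 0 = S" and s_Suc: "s (Suc n) = s n - (s n o\<^sub>L s n)" for n
    by (simp_all add: s_def)
  \<comment> \<open>Both bounds on \<open>s n\<close> have to be carried along:
    \<open>positive_op_diff_square\<close> keeps the next iterate positive, and 1 - (s - s^2) = (1 -
    s) + s^2 keeps it below the identity.\<close>
  have inv: "s n \<in> A \<and> positive_op (s n) \<and> positive_op (id_blinfun - s n)" for n
  proof (induction n)
    case 0
    then show ?case using assms by (simp add: s_0)
  next
    case (Suc n)
    then have "positive_op (s n o\<^sub>L s n)"
      by (intro positive_op_square is_adjoint_self_if_positive_op) (auto simp: positive_op_def)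
    then have "positive_op ((id_blinfun - s n) + (s n o\<^sub>L s n))"
      using Suc by (intro positive_op_add) auto
    then have "positive_op (id_blinfun - (s n - (s n o\<^sub>L s n)))"
      by (simp add: algebra_simps)
    then show ?case
      using Suc by (simp add: s_Suc positive_op_diff_square von_neumann_algebra_diff
          von_neumann_algebra_compose)
  qed
  have sA: "s n \<in> A" "s n o\<^sub>L s n \<in> A" and pos: "positive_op (s n)" for n
    using inv by (auto intro: von_neumann_algebra_compose)
  define q where "q n = Re (\<tau> (s n o\<^sub>L s n))" for n
  have q: "q n = Re (\<tau> (s n)) - Re (\<tau> (s (Suc n)))" for n
    by (simp add: q_def s_Suc finite_trace_diff sA)
  have q_nonneg: "0 \<le> q n" for n
    unfolding q_def
    by (intro finite_trace_nonneg positive_op_square is_adjoint_self_if_positive_op sA pos)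
      (use pos in \<open>auto simp: positive_op_def\<close>)
  \<comment> \<open>A decreasing sequence bounded below by 0 converges, so its consecutive
    differences \<open>q n\<close> tend to 0.\<close>
  have "decseq (\<lambda>n. Re (\<tau> (s n)))"
    using q q_nonneg by (intro decseq_SucI) (metis diff_ge_0_iff_ge)
  then obtain L where "(\<lambda>n. Re (\<tau> (s n))) \<longlonglongrightarrow> L"
    using decseq_convergent[of "\<lambda>n. Re (\<tau> (s n))" 0] finite_trace_nonneg sA pos by metis
  then have "q \<longlonglongrightarrow> L - L"
    unfolding q by (intro tendsto_diff LIMSEQ_Suc)
  then have q_lim: "q \<longlonglongrightarrow> 0"
    by simp
  have mono: "Re (\<tau> (s n o\<^sub>L T)) \<le> Re (\<tau> (S o\<^sub>L T))" for n
  proof (induction n)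
    case (Suc n)
    have "s (Suc n) o\<^sub>L T = (s n o\<^sub>L T) - (s n o\<^sub>L (s n o\<^sub>L T))"
      by (rule blinfun_eqI) (simp add: s_Suc blinfun.bilinear_simps)
    \<comment> \<open>Traciality moves one factor \<open>s n\<close> to the right, leaving a
      conjugate of \<open>T\<close>, which is positive.\<close>
    moreover have "\<tau> (s n o\<^sub>L (s n o\<^sub>L T)) = \<tau> (s n o\<^sub>L T o\<^sub>L s n)"
      by (intro finite_trace_commute von_neumann_algebra_compose sA assms)
    moreover have "0 \<le> Re (\<tau> (s n o\<^sub>L T o\<^sub>L s n))"
      using pos[of n]
      by (intro finite_trace_nonneg positive_op_conj von_neumann_algebra_compose sA assms
          is_adjoint_self_if_positive_op) (auto simp: positive_op_def)
    ultimately have "Re (\<tau> (s (Suc n) o\<^sub>L T)) \<le> Re (\<tau> (s n o\<^sub>L T))"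
      by (simp add: finite_trace_diff von_neumann_algebra_compose sA assms)
    with Suc show ?case
      by simp
  qed (simp add: s_0)
  define a where "a = Re (\<tau> (S o\<^sub>L T))"
  define b where "b = Re (\<tau> (T o\<^sub>L T))"
  \<comment> \<open>For fixed \<open>t\<close> the quadratic term vanishes as n grows, leaving a
    bound affine in \<open>t\<close>; it is violated for large \<open>t\<close> if \<open>a\<close>
    is negative.\<close>
  have bound: "0 \<le> b + 2 * t * a" if "0 \<le> t" for t
  proof (rule LIMSEQ_le_const)
    show "(\<lambda>n. b + 2 * t * a + t\<^sup>2 * q n) \<longlonglongrightarrow> b + 2 * t * a"
      using q_lim by (auto intro!: tendsto_eq_intros)
    have "0 \<le> b + 2 * t * a + t\<^sup>2 * q n" for n
    proof -
      have "0 \<le> b + 2 * t * Re (\<tau> (s n o\<^sub>L T)) + t\<^sup>2 * q n"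
        unfolding b_def q_def
        by (intro finite_trace_cauchy_schwarz sA pos assms that)
      also have "2 * t * Re (\<tau> (s n o\<^sub>L T)) \<le> 2 * t * a"
        unfolding a_def using mono[of n] that by (intro mult_left_mono) auto
      finally show ?thesis by simp
    qed
    then show "\<exists>N. \<forall>n\<ge>N. 0 \<le> b + 2 * t * a + t\<^sup>2 * q n"
      by blast
  qed
  have "0 \<le> a"
  proof (rule ccontr)
    assume "\<not> 0 \<le> a"
    then have a: "a < 0"
      by simp
    have b: "0 \<le> b"
      using bound[of 0] by simp
    \<comment> \<open>The choice t = (b + 1) / (-a) makes the affine bound equal to -b - 2, which is
      negative.\<close>
    have "0 \<le> b + 2 * ((b + 1) / (- a)) * a"
      using a b by (intro bound divide_nonneg_nonneg) auto
    also have "\<dots> = - b - 2"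
      using a by simp
    finally show False
      using b by simp
  qed
  then show ?thesis
    by (simp add: a_def)
qed

text \<open>Dividing a nonzero \<open>S\<close> by its norm reduces to the contraction case.\<close>

lemma finite_trace_compose_nonneg:
  assumes "S \<in> A" "T \<in> A" "positive_op S" "positive_op T"
  shows "0 \<le> Re (\<tau> (S o\<^sub>L T))"
proof (cases "S = 0")
  case True
  then show ?thesis
    using finite_trace_scaleR[of "S o\<^sub>L T" 0] von_neumann_algebra_compose[OF assms(1,2)] by simp
next
  case False
  let ?S = "inverse (norm S) *\<^sub>R S"
  have "0 \<le> Re (\<tau> (?S o\<^sub>L T))"
    using False assms
    by (intro finite_trace_compose_nonneg_contraction positive_op_id_diff positive_op_scaleR
        von_neumann_algebra_scaleR) auto
  also have "?S o\<^sub>L T = inverse (norm S) *\<^sub>R (S o\<^sub>L T)"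
    by (rule blinfun_eqI) (simp add: blinfun.bilinear_simps)
  finally show ?thesis
    using False assms
    by (simp add: finite_trace_scaleR von_neumann_algebra_compose zero_le_mult_iff flip: of_real_inverse)
qed

end

end

section \<open>Evaluation on matrix units and the conclusion\<close>

definition matrix_unit :: "'m \<Rightarrow> 'n \<Rightarrow> complex^'n^'m"
  where "matrix_unit a b = (\<chi> i j. if i = a \<and> j = b then 1 else 0)"

text \<open>A matrix unit collapses both sums of the matrix product, isolating the trace of a single
  product of entries.\<close>

lemma id_tensor_matrix_unit:
  "id_tensor \<tau> (opmat_mult (opmat_mult Z (tensor_one (matrix_unit a b))) W) $ i $ j =
    \<tau> (Z $ i $ a o\<^sub>L W $ b $ j)"
proof -
  have "(\<Sum>k\<in>UNIV. Z $ i $ k o\<^sub>L scalar_op (if k = a \<and> l = b then 1 else 0)) =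
      (if l = b then Z $ i $ a else 0)" for l
  proof -
    have "(\<Sum>k\<in>UNIV. Z $ i $ k o\<^sub>L scalar_op (if k = a \<and> l = b then 1 else 0)) =
      (\<Sum>k\<in>UNIV. if k = a then (if l = b then Z $ i $ k else 0) else 0)"
      by (intro sum.cong) (auto simp: blinfun_compose_id)
    then show ?thesis by simp
  qed
  moreover have "(\<Sum>l\<in>UNIV. (if l = b then Z $ i $ a else 0) o\<^sub>L W $ l $ j) =
      (\<Sum>l\<in>UNIV. if l = b then Z $ i $ a o\<^sub>L W $ l $ j else 0)"
    by (intro sum.cong) auto
  ultimately show ?thesis
    by (simp add: id_tensor_def opmat_mult_def tensor_one_def matrix_unit_def map_matrix_def)
qed

lemma matrix_mult_matrix_unit:
  fixes M :: "complex^'n^'p" and N :: "complex^'q^'m"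
  shows "(M ** matrix_unit a b ** N) $ i $ j = M $ i $ a * N $ b $ j"
proof -
  have "(\<Sum>k\<in>UNIV. M $ i $ k * (if k = a \<and> l = b then 1 else 0)) =
      (if l = b then M $ i $ a else 0)" for l
    by (cases "l = b") (simp_all add: if_distrib cong: if_cong)
  then show ?thesis
    by (simp add: matrix_matrix_mult_def matrix_unit_def if_distrib[of "\<lambda>x. x * _"] cong: if_cong)
qed

theorem theorem2p13:
  fixes \<Phi> :: "complex^'n^'n \<Rightarrow> complex^'n^'n"
    and K :: "'d::finite \<Rightarrow> real^'n^'n"
  assumes "quantum_channel \<Phi>"
    and "kraus_operators \<Phi> (\<lambda>i. map_matrix complex_of_real (K i))"
    and "lin_independent_family (\<lambda>i. map_matrix complex_of_real (K i))"
    and "positively_factorizable TYPE('h::chilbert_space) \<Phi>"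
  shows "\<exists>C :: (real^'d) set. cone C \<and> dual_cone C = C \<and> C \<subseteq> nonnegativity_cone K"
proof -
  obtain A \<tau> and Z :: "('h \<Rightarrow>\<^sub>L 'h)^'n^'n" where
    A: "von_neumann_algebra A" and \<tau>: "finite_trace A \<tau>"
    and Z: "\<And>i j. Z $ i $ j \<in> A" "\<And>i j. positive_op (Z $ i $ j)"
    and fact: "\<And>X. \<Phi> X = id_tensor \<tau> (opmat_mult (opmat_mult Z (tensor_one X)) (opmat_adj Z))"
    using assms(4) unfolding positively_factorizable_def finite_von_neumann_algebra_def by blast
  define w :: "'n \<Rightarrow> 'n \<Rightarrow> real^'d" where "w k l = (\<chi> m. K m $ k $ l)" for k l
  have "0 \<le> inner (w i a) (w j b)" for i a j b
  proof -
    \<comment> \<open>In the Kraus form this entry is the sum over m of \<open>K m $ i $ a\<close>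
      times the conjugate of \<open>K m $ j $ b\<close>; the conjugate disappears because the
      \<open>K m\<close> are real.\<close>
    have "complex_of_real (inner (w i a) (w j b)) = \<Phi> (matrix_unit a b) $ i $ j"
      using assms(2)
      by (simp add: kraus_operators_def matrix_mult_matrix_unit w_def inner_vec_def
          cmatrix_adj_def map_matrix_def transpose_def)
    \<comment> \<open>The adjoint in \<open>opmat_adj Z\<close> drops out because positive entries
      are self-adjoint.\<close>
    also have "\<dots> = \<tau> (Z $ i $ a o\<^sub>L Z $ j $ b)"
      by (simp add: fact id_tensor_matrix_unit opmat_adj_def adj_positive_op Z)
    finally show ?thesis
      using finite_trace_compose_nonneg[OF A \<tau> Z(1) Z(1) Z(2) Z(2), of i a j b]
      by (metis Re_complex_of_real)
  qed
  then have "0 \<le> inner x y" if "x \<in> range (case_prod w)" "y \<in> range (case_prod w)" for x y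
    using that by auto
  then obtain C where C: "cone C" "dual_cone C = C" "range (case_prod w) \<subseteq> C"
    using exists_self_dual_cone_containing by blast
  moreover have "v \<in> nonnegativity_cone K" if "v \<in> C" for v
  proof -
    \<comment> \<open>Both vectors lie in \<open>C = dual_cone C\<close>, and their pairing is the
      (k, l) entry of the combination of the \<open>K i\<close> with coefficients
      \<open>v\<close>.\<close>
    have "0 \<le> inner v (w k l)" for k l
      using C that by (force simp: dual_cone_def)
    then show ?thesis
      by (simp add: nonnegativity_cone_def w_def inner_vec_def)
  qed
  ultimately show ?thesis
    by blast
qed

end
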